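(* For every integer $k\ge2$, the formal power series $$H_k(x,q):=\sum_{n\ge1}x^n\sum_{w\in\mathcal F_{n,k}}q^{\mathrm{Ham}(G(w))}$$ is equal to $$\frac{x\left((1-x)x\bigl(1-x^{2\lfloor (k-1)/2\rfloor}\bigr)-q(1+x)(1-2x+x^{k+1})\bigl(-2+x+x^{2\lfloor k/2\rfloor}\bigr)\right)}{(1-2x+x^{k+1})\left(1-x-2x^2+x^3+x^{2(1+\lfloor k/2\rfloor)}\right)}.$$
   Context: For integers $k\ge 2$, $n\ge1$, $\mathcal F_{n,k}$ is the set of binary words $w=w_1\cdots w_n$ with no $k$ consecutive $1$'s. $P(w)$ is the bargraph polyomino formed by the unit squares $[i-1,i]\times[j-1,j]$, $1\le i\le n$, $1\le j\le w_i+1$. $G(w)$ is the graph whose vertices are the corners of the cells of $P(w)$ and whose edges are the cell sides. $\mathrm{Ham}(G)=1$ if $G$ has a Hamiltonian cycle (a cycle visiting every vertex exactly once) and $\mathrm{Ham}(G)=0$ otherwise. *)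

theory Defs
  imports
    "HOL-Computational_Algebra.Computational_Algebra"
    "HOL-Library.Sublist"
begin

text \<open>\<^const>\<open>sublist\<close> is the contiguous-factor relation on lists.\<close>

definition free_words :: "nat \<Rightarrow> nat \<Rightarrow> nat list set" where
  "free_words n k =
    {w. length w = n \<and> set w \<subseteq> {0, 1} \<and> \<not> sublist (replicate k 1) w}"

lemma finite_free_words: "finite (free_words n k)"
  by (rule finite_subset[OF _ finite_lists_length_eq[of "{0, 1::nat}" n]])
    (auto simp: free_words_def)

text \<open>The pair \<open>(i, j)\<close> stands for the unit square \<open>[i - 1, i] \<times> [j - 1, j]\<close>; letters
  are numbered from 1, so that \<open>w\<^sub>i\<close> is \<open>w ! (i - 1)\<close>.\<close>

definition bargraph :: "nat list \<Rightarrow> (nat \<times> nat) set" where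
  "bargraph w = {(i, j). 1 \<le> i \<and> i \<le> length w \<and> 1 \<le> j \<and> j \<le> w ! (i - 1) + 1}"

definition cell_corners :: "nat \<times> nat \<Rightarrow> (nat \<times> nat) set" where
  "cell_corners = (\<lambda>(i, j). {(i - 1, j - 1), (i, j - 1), (i, j), (i - 1, j)})"

definition cell_sides :: "nat \<times> nat \<Rightarrow> (nat \<times> nat) set set" where
  "cell_sides = (\<lambda>(i, j).
    {{(i - 1, j - 1), (i, j - 1)}, {(i, j - 1), (i, j)},
     {(i, j), (i - 1, j)}, {(i - 1, j), (i - 1, j - 1)}})"

text \<open>A simple graph is given by its vertex set and its set of two-element edges.\<close>

type_synonym 'v graph = "'v set \<times> 'v set set"

definition word_graph :: "nat list \<Rightarrow> (nat \<times> nat) graph" where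
  "word_graph w = (\<Union>c\<in>bargraph w. cell_corners c, \<Union>c\<in>bargraph w. cell_sides c)"

definition hamiltonian_cycle :: "'v graph \<Rightarrow> 'v list \<Rightarrow> bool" where
  "hamiltonian_cycle G p \<longleftrightarrow>
    3 \<le> length p \<and> distinct p \<and> set p = fst G \<and>
    (\<forall>i < length p. {p ! i, p ! (Suc i mod length p)} \<in> snd G)"

definition Ham :: "'v graph \<Rightarrow> nat" where
  "Ham G = (if \<exists>p. hamiltonian_cycle G p then 1 else 0)"

text \<open>Power series in \<open>x\<close> are taken over the field of fractions of \<open>\<int>[q]\<close>, which contains
  \<open>\<int>[q]\<close>, so that quotients of power series are available.\<close>

definition qvar :: "int poly fract" where
  "qvar = to_fract [:0, 1:]"

definition H :: "nat \<Rightarrow> int poly fract fps" where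
  "H k = Abs_fps (\<lambda>n. if n \<ge> 1 then \<Sum>w\<in>free_words n k. qvar ^ Ham (word_graph w) else 0)"

end

theory Submission
  imports Defs
begin

text \<open>The graph of a word is Hamiltonian iff all maximal runs of ones have odd length. A
  Hamiltonian cycle crosses every gap between neighbouring vertex columns an even, positive number
  of times, hence exactly twice. Summing degrees over a column of three vertices then shows that
  exactly one of the two middle-row edges at such a column is used (counting virtual used edges
  beyond both ends of the word), so use of the middle row alternates along a run; at a zero
  letter the middle row is always used, and so the run must be odd. Conversely, for odd runs the
  bottom row closes up with a comb-shaped upper path.

  Words all of whose run lengths lie in a set \<open>S\<close> have the generating function
  \<open>A / (1 - x A)\<close>, where \<open>A\<close> is the sum of \<open>x\<^sup>m\<close> over \<open>m \<in> S\<close>: split the word at its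
  last zero. This is applied to all run lengths below \<open>k\<close> and to the zero or odd ones.\<close>

section \<open>Words with prescribed run lengths\<close>

text \<open>\<open>run w i\<close> is the length of the run of ones that ends just before index \<open>i\<close>.\<close>

fun run :: "nat list \<Rightarrow> nat \<Rightarrow> nat" where
  "run w 0 = 0"
| "run w (Suc i) = (if w ! i = 1 then Suc (run w i) else 0)"

lemma run_le: "run w i \<le> i"
  by (induction i) auto

text \<open>Trades the recursion for a condition on the letters. The negation of its case
  \<open>Suc m\<close> is what locates the zero in front of a run of exact length
  \<open>m\<close>.\<close>

lemma le_run_iff: "m \<le> run w i \<longleftrightarrow> m \<le> i \<and> (\<forall>j. i - m \<le> j \<and> j < i \<longrightarrow> w ! j = 1)"
proof (induction i arbitrary: m)
  case (Suc i)
  show ?case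
  proof (cases m)
    case (Suc m')
    have "(\<forall>j. Suc i - m \<le> j \<and> j < Suc i \<longrightarrow> w ! j = 1) \<longleftrightarrow>
        w ! i = 1 \<and> (\<forall>j. i - m' \<le> j \<and> j < i \<longrightarrow> w ! j = 1)" if "m \<le> Suc i"
      using that Suc by (auto simp: less_Suc_eq)
    then show ?thesis using Suc.IH[of m'] Suc by auto
  qed simp
qed simp

lemma run_append_left: "i \<le> length u \<Longrightarrow> run (u @ v) i = run u i"
  by (induction i) (auto simp: nth_append)

lemma run_append_ones:
  "i \<le> m \<Longrightarrow> run (u @ 0 # replicate m 1) (Suc (length u + i)) = i"
  by (induction i) (auto simp: nth_append)

lemma run_replicate: "i \<le> m \<Longrightarrow> run (replicate m 1) i = i"
  by (induction i) auto

text \<open>The empty runs before a zero or at the end of the word count, with length 0.\<close>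

definition run_words :: "nat set \<Rightarrow> nat \<Rightarrow> nat list set" where
  "run_words S n = {w. length w = n \<and> set w \<subseteq> {0, 1} \<and>
     (\<forall>i\<le>n. i = n \<or> w ! i = 0 \<longrightarrow> run w i \<in> S)}"

lemma finite_run_words: "finite (run_words S n)"
  by (rule finite_subset[OF _ finite_lists_length_eq[of "{0, 1::nat}" n]])
    (auto simp: run_words_def)

lemma run_words_last_run_all:
  "{w \<in> run_words S n. run w n = n} = (if n \<in> S then {replicate n 1} else {})"
proof -
  have "w = replicate n 1" if "w \<in> run_words S n" "run w n = n" for w
  proof (rule nth_equalityI)
    show "length w = length (replicate n 1)" using that by (simp add: run_words_def)
    fix j assume "j < length w"
    then show "w ! j = replicate n 1 ! j"
      using that le_run_iff[of n w n] by (simp add: run_words_def)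
  qed
  moreover have "replicate n 1 \<in> run_words S n \<longleftrightarrow> n \<in> S"
  proof -
    have "(\<forall>i\<le>n. i = n \<or> replicate n 1 ! i = (0::nat) \<longrightarrow> run (replicate n 1) i \<in> S) \<longleftrightarrow> n \<in> S"
      by (metis le_neq_implies_less nth_replicate order_refl run_replicate zero_neq_one)
    then show ?thesis by (auto simp: run_words_def)
  qed
  moreover have "run (replicate n 1) n = n"
    by (rule run_replicate) simp
  ultimately show ?thesis
    by auto
qed

text \<open>The end of \<open>u\<close> becomes the position of the separating zero, so the runs
  tested in \<open>u\<close> are tested in the long word as well. Only the final run is new, and no
  test falls strictly inside it.\<close>

lemma append_zero_ones_in_run_words_iff:
  "u @ 0 # replicate m 1 \<in> run_words S (Suc (length u + m)) \<longleftrightarrow>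
    m \<in> S \<and> u \<in> run_words S (length u)" (is "?w \<in> _ \<longleftrightarrow> _")
proof -
  let ?n = "Suc (length u + m)"
  have "(\<forall>i\<le>?n. i = ?n \<or> ?w ! i = 0 \<longrightarrow> run ?w i \<in> S) \<longleftrightarrow>
      m \<in> S \<and> (\<forall>i\<le>length u. i = length u \<or> u ! i = 0 \<longrightarrow> run u i \<in> S)" (is "?L \<longleftrightarrow> ?R")
  proof
    assume L: ?L
    have "m \<in> S"
      using L[rule_format, of ?n] run_append_ones[of m m u] by simp
    moreover have "run u i \<in> S" if "i \<le> length u" "i = length u \<or> u ! i = 0" for i
      using L[rule_format, of i] that run_append_left[of i u] by (auto simp: nth_append)
    ultimately show ?R by blast
  next
    assume R: ?R
    show ?L
    proof (intro allI impI)
      fix i assume i: "i \<le> ?n" "i = ?n \<or> ?w ! i = 0"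
      consider "i = ?n" | "i \<le> length u" | "length u < i" "i < ?n"
        using i(1) by linarith
      then show "run ?w i \<in> S"
      proof cases
        case 1
        then show ?thesis using R run_append_ones[of m m u] by simp
      next
        case 2
        then have "i = length u \<or> u ! i = 0"
          using i by (auto simp: nth_append split: if_splits)
        then show ?thesis using 2 R run_append_left[of i u] by metis
      next
        case 3
        then have "?w ! i = 1"
          by (auto simp: nth_append nth_Cons split: nat.split)
        then show ?thesis using 3 i by simp
      qed
    qed
  qed
  then show ?thesis by (auto simp: run_words_def)
qed

text \<open>A final run shorter than the word has a zero in front of it. Cutting at this zero leaves
  an arbitrary admissible word of length \<open>n - 1 - m\<close>.\<close>

lemma run_words_last_run:
  assumes "m < n"
  shows "{w \<in> run_words S n. run w n = m} =
    (if m \<in> S then (\<lambda>u. u @ 0 # replicate m 1) ` run_words S (n - 1 - m) else {})"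
proof -
  define l where "l = n - 1 - m"
  have n: "n = Suc (l + m)" using assms by (simp add: l_def)
  have decomp: "w = take l w @ 0 # replicate m 1"
    if w: "w \<in> run_words S n" "run w n = m" for w
  proof -
    have len: "length w = n" and set: "set w \<subseteq> {0, 1}" using w by (auto simp: run_words_def)
    have ones: "w ! j = 1" if "l < j" "j < n" for j
      using le_run_iff[of m w n] w(2) that n by auto
    \<comment> \<open>Maximality of the final run: some letter from \<open>l\<close> on is not a
      one, and by \<open>ones\<close> it can only be the one at \<open>l\<close>.\<close>
    have "\<not> Suc m \<le> run w n" using w(2) by simp
    then obtain j where j: "l \<le> j" "j < n" "w ! j \<noteq> 1"
      using n unfolding le_run_iff by auto
    then have "j = l" using ones[of j] by (cases "j = l") auto
    then have "w ! l = 0" using j set len by (meson insertE nth_mem singletonD subsetD)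
    then show ?thesis
      using n len ones by (auto intro!: nth_equalityI simp: nth_append nth_Cons split: nat.split)
  qed
  have iff: "u @ 0 # replicate m 1 \<in> run_words S n \<longleftrightarrow> m \<in> S \<and> u \<in> run_words S l"
    if "length u = l" for u
    using append_zero_ones_in_run_words_iff[of u m S] that n by simp
  have len: "length u = l" if "u \<in> run_words S l" for u
    using that by (simp add: run_words_def)
  have run: "run (u @ 0 # replicate m 1) n = m" if "length u = l" for u
    using run_append_ones[of m m u] that n by simp
  have "w \<in> (if m \<in> S then (\<lambda>u. u @ 0 # replicate m 1) ` run_words S l else {})"
    if w: "w \<in> run_words S n" "run w n = m" for w
  proof -
    have "length (take l w) = l" using w n by (auto simp: run_words_def)
    with iff[of "take l w"] decomp[OF w] w(1) have "m \<in> S \<and> take l w \<in> run_words S l"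
      by simp
    then show ?thesis using decomp[OF w] by auto
  qed
  then have "{w \<in> run_words S n. run w n = m} \<subseteq>
      (if m \<in> S then (\<lambda>u. u @ 0 # replicate m 1) ` run_words S l else {})"
    by blast
  moreover have "(\<lambda>u. u @ 0 # replicate m 1) ` run_words S l \<subseteq> {w \<in> run_words S n. run w n = m}"
    if "m \<in> S"
    using that iff len run by auto
  ultimately show ?thesis
    unfolding l_def[symmetric] by (cases "m \<in> S") auto
qed

text \<open>Sorts the words by the length of their final run. The isolated term is the word
  consisting of ones only.\<close>

lemma card_run_words:
  "card (run_words S n) =
    of_bool (n \<in> S) + (\<Sum>m<n. of_bool (m \<in> S) * card (run_words S (n - 1 - m)))"
proof -
  have "card (run_words S n) = (\<Sum>m\<in>{..n}. card {w \<in> run_words S n. run w n = m})"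
    using sum.group[OF finite_run_words finite_atMost, of "\<lambda>w. run w n" S n n "\<lambda>_. 1::nat"] run_le
    by (simp add: image_subset_iff)
  also have "\<dots> = card {w \<in> run_words S n. run w n = n}
      + (\<Sum>m<n. card {w \<in> run_words S n. run w n = m})"
    by (simp add: lessThan_Suc_atMost[symmetric])
  also have "card {w \<in> run_words S n. run w n = n} = of_bool (n \<in> S)"
    by (simp add: run_words_last_run_all)
  also have "(\<Sum>m<n. card {w \<in> run_words S n. run w n = m}) =
      (\<Sum>m<n. of_bool (m \<in> S) * card (run_words S (n - 1 - m)))"
    by (intro sum.cong refl) (auto simp: run_words_last_run card_image inj_on_def)
  finally show ?thesis .
qed

section \<open>Generating functions of words with prescribed run lengths\<close>

definition run_fps :: "nat set \<Rightarrow> 'a::field fps" where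
  "run_fps S = Abs_fps (\<lambda>n. of_bool (n \<in> S))"

definition run_words_fps :: "nat set \<Rightarrow> 'a::field fps" where
  "run_words_fps S = Abs_fps (\<lambda>n. of_nat (card (run_words S n)))"

text \<open>The recurrence of \<open>card_run_words\<close> read as a convolution; the factor
  \<open>fps_X\<close> accounts for the separating zero.\<close>

lemma run_words_fps_eq:
  "run_words_fps S = run_fps S + fps_X * run_fps S * (run_words_fps S :: 'a::field fps)"
proof (rule fps_ext)
  fix n
  show "run_words_fps S $ n = (run_fps S + fps_X * run_fps S * run_words_fps S :: 'a fps) $ n"
  proof (cases n)
    case 0
    have "card (run_words S 0) = of_bool (0 \<in> S)"
      by (subst card_run_words) simp
    then show ?thesis
      by (simp add: run_words_fps_def run_fps_def 0)
  next
    case (Suc l)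
    have "of_nat (card (run_words S n)) = of_bool (n \<in> S) +
        (\<Sum>m\<le>l. of_bool (m \<in> S) * of_nat (card (run_words S (l - m))) :: 'a)"
      by (subst card_run_words) (simp add: Suc lessThan_Suc_atMost)
    also have "\<dots> = (run_fps S + fps_X * (run_fps S * run_words_fps S)) $ n"
      unfolding fps_add_nth fps_X_mult_nth
      by (simp add: Suc fps_mult_nth atLeast0AtMost run_words_fps_def run_fps_def)
    finally show ?thesis
      by (simp add: run_words_fps_def mult.assoc)
  qed
qed

lemma run_fps_lessThan: "(1 - fps_X) * run_fps {..<k} = 1 - (fps_X :: 'a::field fps) ^ k"
proof -
  have "run_fps {..<k} = (\<Sum>m<k. (fps_X :: 'a fps) ^ m)"
    by (rule fps_ext) (simp add: run_fps_def fps_sum_nth of_bool_def)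
  then show ?thesis
    by (simp add: one_diff_power_eq)
qed

text \<open>The odd numbers below \<open>k\<close> are \<open>2 * j + 1\<close> with
  \<open>j < k div 2\<close>, which gives a geometric series in the square of \<open>fps_X\<close>.
  Positivity of \<open>k\<close> puts 0 into the set.\<close>

lemma run_fps_odd_lessThan:
  assumes "k > 0"
  shows "(1 - fps_X\<^sup>2) * run_fps {m. m < k \<and> (m = 0 \<or> odd m)} =
    1 - fps_X\<^sup>2 + fps_X - fps_X * (fps_X :: 'a::field fps) ^ (2 * (k div 2))"
proof -
  have "run_fps {m. m < k \<and> (m = 0 \<or> odd m)} = 1 + (\<Sum>j<k div 2. (fps_X :: 'a fps) ^ (2 * j + 1))"
    (is "?L = ?R")
  proof (rule fps_ext)
    fix n
    have "(\<Sum>j<k div 2. (fps_X :: 'a fps) ^ (2 * j + 1)) $ n =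
        (\<Sum>j<k div 2. if n = 2 * j + 1 then 1 else 0)"
      by (simp add: fps_sum_nth del: power_Suc)
    also have "\<dots> = of_bool (odd n \<and> n < k)"
    proof (cases "odd n")
      case True
      then obtain l where "n = 2 * l + 1" by (elim oddE)
      then show ?thesis by auto
    next
      case False
      then have "n \<noteq> 2 * j + 1" for j by auto
      then show ?thesis using False by simp
    qed
    finally show "?L $ n = ?R $ n"
      using assms by (auto simp: run_fps_def)
  qed
  also have "(\<Sum>j<k div 2. (fps_X :: 'a fps) ^ (2 * j + 1)) = fps_X * (\<Sum>j<k div 2. (fps_X\<^sup>2) ^ j)"
    by (simp add: sum_distrib_left power_mult)
  finally have "(1 - fps_X\<^sup>2) * run_fps {m. m < k \<and> (m = 0 \<or> odd m)} =
      1 - fps_X\<^sup>2 + fps_X * ((1 - fps_X\<^sup>2) * (\<Sum>j<k div 2. ((fps_X :: 'a fps)\<^sup>2) ^ j))"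
    by (simp add: algebra_simps)
  then show ?thesis
    unfolding one_diff_power_eq[symmetric] by (simp add: power_mult right_diff_distrib)
qed

text \<open>A block of \<open>k\<close> ones extends to the right up to the next zero or the end of
  the word, and the run measured there has length at least \<open>k\<close>.\<close>

lemma free_words_eq_run_words: "free_words n k = run_words {..<k} n"
proof -
  have *: "sublist (replicate k 1) w \<longleftrightarrow> (\<exists>i\<le>n. (i = n \<or> w ! i = 0) \<and> k \<le> run w i)"
    if len: "length w = n" and set: "set w \<subseteq> {0, 1}" for w
  proof
    assume "sublist (replicate k 1) w"
    then obtain u v where w: "w = u @ replicate k 1 @ v" by (auto simp: sublist_def)
    \<comment> \<open>The least such \<open>i\<close> is the first position after the block at which
      a run is tested; all letters from the start of the block up to it are ones.\<close>
    let ?P = "\<lambda>i. length u + k \<le> i \<and> (i = n \<or> w ! i = 0)"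
    have "?P n" using w len by auto
    define i where "i = (LEAST i. ?P i)"
    have i: "?P i" "i \<le> n"
      unfolding i_def using LeastI[of ?P, OF \<open>?P n\<close>] Least_le[of ?P, OF \<open>?P n\<close>] by blast+
    have "w ! j = 1" if "length u \<le> j" "j < i" for j
    proof (cases "j < length u + k")
      case True
      then show ?thesis using that w by (simp add: nth_append less_diff_conv2)
    next
      case False
      have "j < n" using that i by simp
      have "w ! j \<noteq> 0" using not_less_Least[of j ?P] that False by (auto simp: i_def)
      moreover have "w ! j \<in> {0, 1}" using set nth_mem[of j w] len \<open>j < n\<close> by blast
      ultimately show ?thesis by simp
    qed
    then have "k \<le> run w i" unfolding le_run_iff using i by auto
    then show "\<exists>i\<le>n. (i = n \<or> w ! i = 0) \<and> k \<le> run w i" using i by blast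
  next
    assume "\<exists>i\<le>n. (i = n \<or> w ! i = 0) \<and> k \<le> run w i"
    then obtain i where i: "i \<le> n" "k \<le> run w i" by blast
    then have ones: "k \<le> i" "\<And>j. i - k \<le> j \<Longrightarrow> j < i \<Longrightarrow> w ! j = 1" by (auto simp: le_run_iff)
    have "take k (drop (i - k) w) = replicate k 1"
      using ones i len by (intro nth_equalityI) auto
    then show "sublist (replicate k 1) w"
      by (metis sublist_take sublist_drop sublist_order.order_trans)
  qed
  show ?thesis
    unfolding free_words_def run_words_def
    by (intro Collect_cong conj_cong refl) (simp only: * lessThan_iff not_le[symmetric], blast)
qed

section \<open>Cycles as edge sets\<close>

definition cycle_edges :: "'v list \<Rightarrow> 'v set set" where
  "cycle_edges p = (\<lambda>i. {p ! i, p ! (Suc i mod length p)}) ` {..<length p}"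

text \<open>The neighbours are the cyclic successor \<open>p ! s\<close> and predecessor
  \<open>p ! t\<close>, which differ because the length is at least 3.\<close>

lemma card_cycle_neighbours:
  assumes len: "3 \<le> length p" and dist: "distinct p" and v: "v \<in> set p"
  shows "card {u. {u, v} \<in> cycle_edges p} = 2"
proof -
  let ?L = "length p"
  obtain j where j: "j < ?L" "v = p ! j" using v by (auto simp: in_set_conv_nth)
  define s where "s = Suc j mod ?L"
  define t where "t = (if j = 0 then ?L - 1 else j - 1)"
  have st: "s < ?L" "t < ?L" "s \<noteq> t" "Suc t mod ?L = j"
    using j len by (auto simp: s_def t_def mod_Suc)
  have "{u. {u, v} \<in> cycle_edges p} = {p ! s, p ! t}"
  proof (intro equalityI subsetI)
    fix u assume "u \<in> {u. {u, v} \<in> cycle_edges p}"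
    then obtain i where i: "i < ?L" "{u, v} = {p ! i, p ! (Suc i mod ?L)}"
      by (auto simp: cycle_edges_def)
    have S: "Suc i mod ?L < ?L" using i(1) by (intro mod_less_divisor) linarith
    from i(2) consider "u = p ! (Suc i mod ?L)" "v = p ! i" | "u = p ! i" "v = p ! (Suc i mod ?L)"
      by (auto simp: doubleton_eq_iff)
    then show "u \<in> {p ! s, p ! t}"
    proof cases
      case 1
      then have "i = j" using j i dist by (simp add: nth_eq_iff_index_eq)
      then show ?thesis using 1 by (simp add: s_def)
    next
      case 2
      then have "Suc i mod ?L = j" using j S dist by (simp add: nth_eq_iff_index_eq)
      then have "i = t" using i(1) by (auto simp: t_def mod_Suc split: if_splits)
      then show ?thesis using 2 by simp
    qed
  next
    fix u assume "u \<in> {p ! s, p ! t}"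
    then consider "u = p ! s" | "u = p ! t" by blast
    then show "u \<in> {u. {u, v} \<in> cycle_edges p}"
    proof cases
      case 1
      have "{p ! j, p ! (Suc j mod ?L)} \<in> cycle_edges p"
        using j unfolding cycle_edges_def by blast
      then show ?thesis using 1 j by (simp add: s_def insert_commute)
    next
      case 2
      have "{p ! t, p ! (Suc t mod ?L)} \<in> cycle_edges p"
        using st unfolding cycle_edges_def by blast
      then show ?thesis using 2 j st by simp
    qed
  qed
  moreover have "p ! s \<noteq> p ! t" using st dist by (simp add: nth_eq_iff_index_eq)
  ultimately show ?thesis by simp
qed

lemma cycle_edges_not_singleton:
  assumes "3 \<le> length p" "distinct p"
  shows "{v} \<notin> cycle_edges p"
proof
  assume "{v} \<in> cycle_edges p"
  then obtain i where i: "i < length p" "{v} = {p ! i, p ! (Suc i mod length p)}"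
    by (auto simp: cycle_edges_def)
  moreover have "Suc i mod length p < length p" using i(1) by (intro mod_less_divisor) linarith
  ultimately have "i = Suc i mod length p"
    using assms(2) by (auto simp: nth_eq_iff_index_eq)
  then show False using i assms(1) by (simp add: mod_Suc split: if_splits)
qed

text \<open>If \<open>P\<close> never changed between cyclically consecutive vertices, it would be
  constant along the list. The cuts of interest lie between neighbouring columns.\<close>

lemma cycle_crosses_cut:
  assumes x: "x \<in> set p" "P x" and y: "y \<in> set p" "\<not> P y"
  shows "\<exists>u v. {u, v} \<in> cycle_edges p \<and> P u \<and> \<not> P v"
proof -
  have "\<exists>i<length p. P (p ! i) \<noteq> P (p ! (Suc i mod length p))"
  proof (rule ccontr)
    assume no: "\<not> ?thesis"
    have "P (p ! i) = P (p ! 0)" if "i < length p" for i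
      using that
    proof (induction i)
      case (Suc i)
      then show ?case using no by (metis Suc_lessD mod_less)
    qed simp
    then show False using x y by (metis in_set_conv_nth)
  qed
  then obtain i where i: "i < length p" "P (p ! i) \<noteq> P (p ! (Suc i mod length p))" by blast
  then have "{p ! i, p ! (Suc i mod length p)} \<in> cycle_edges p"
    unfolding cycle_edges_def by blast
  then show ?thesis using i(2) by (metis insert_commute)
qed

lemma hamiltonian_cycle_iff:
  "hamiltonian_cycle G p \<longleftrightarrow>
    3 \<le> length p \<and> distinct p \<and> set p = fst G \<and> cycle_edges p \<subseteq> snd G"
  by (auto simp: hamiltonian_cycle_def cycle_edges_def)

lemma cycle_edges_subset_if_successively:
  assumes "successively (\<lambda>u v. {u, v} \<in> E) p" "{last p, hd p} \<in> E"
  shows "cycle_edges p \<subseteq> E"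
proof
  fix e assume "e \<in> cycle_edges p"
  then obtain i where i: "i < length p" "e = {p ! i, p ! (Suc i mod length p)}"
    by (auto simp: cycle_edges_def)
  show "e \<in> E"
  proof (cases "Suc i = length p")
    case True
    then have "p \<noteq> []" "i = length p - 1" by auto
    then show ?thesis using assms(2) i True by (simp add: last_conv_nth hd_conv_nth)
  next
    case False
    then show ?thesis using assms(1) i by (auto simp: successively_conv_nth)
  qed
qed

section \<open>The graph of a word\<close>

text \<open>Vertex column \<open>i\<close> borders the cells of the letters \<open>w ! i\<close> and
  \<open>w ! (i - 1)\<close>, as far as these exist, and reaches as high as the taller one.\<close>

lemma fst_word_graph: "fst (word_graph w) =
  {(i, j). (i < length w \<and> j \<le> Suc (w ! i)) \<or> (0 < i \<and> i \<le> length w \<and> j \<le> Suc (w ! (i - 1)))}"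
  (is "?L = ?R")
proof (intro equalityI subsetI)
  fix v assume "v \<in> ?L"
  then obtain i j where "1 \<le> i" "i \<le> length w" "1 \<le> j" "j \<le> w ! (i - 1) + 1"
      "v \<in> {(i - 1, j - 1), (i, j - 1), (i, j), (i - 1, j)}"
    by (auto simp: word_graph_def bargraph_def cell_corners_def)
  then show "v \<in> ?R" by auto
next
  fix v assume "v \<in> ?R"
  then obtain i j where v: "v = (i, j)" and
    "(i < length w \<and> j \<le> Suc (w ! i)) \<or> (0 < i \<and> i \<le> length w \<and> j \<le> Suc (w ! (i - 1)))" by auto
  then obtain i' where i': "1 \<le> i'" "i' \<le> length w" "j \<le> Suc (w ! (i' - 1))" "i = i' \<or> i = i' - 1"
    by (metis Suc_leI diff_Suc_1 le_add1 plus_1_eq_Suc One_nat_def)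
  \<comment> \<open>The vertex is taken as an upper corner of its cell, except in the bottom row,
    where only the lower corners of the first cell are available.\<close>
  have "(i', max 1 j) \<in> bargraph w" using i' by (auto simp: bargraph_def)
  moreover have "v \<in> cell_corners (i', max 1 j)"
    using i' v by (cases "j = 0") (auto simp: cell_corners_def)
  ultimately show "v \<in> ?L" unfolding word_graph_def fst_conv by blast
qed

text \<open>A horizontal side belongs to one column of cells, whereas a vertical side may be shared
  by two; hence the disjunction in the second set only.\<close>

lemma snd_word_graph: "snd (word_graph w) =
  {{(i, j), (Suc i, j)} | i j. i < length w \<and> j \<le> Suc (w ! i)} \<union>
  {{(i, j), (i, Suc j)} | i j.
    (i < length w \<and> j \<le> w ! i) \<or> (0 < i \<and> i \<le> length w \<and> j \<le> w ! (i - 1))}"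
  (is "?L = ?A \<union> ?B")
proof (intro equalityI subsetI)
  fix e assume "e \<in> ?L"
  then obtain i j where c: "1 \<le> i" "i \<le> length w" "1 \<le> j" "j \<le> w ! (i - 1) + 1"
      "e \<in> cell_sides (i, j)"
    by (auto simp: word_graph_def bargraph_def)
  obtain a b where ab: "i = Suc a" "j = Suc b" using c by (metis Suc_le_D One_nat_def)
  have "e = {(a, b), (Suc a, b)} \<or> e = {(Suc a, b), (Suc a, Suc b)} \<or>
      e = {(a, Suc b), (Suc a, Suc b)} \<or> e = {(a, b), (a, Suc b)}"
    using c(5) ab by (auto simp: cell_sides_def insert_commute)
  moreover have "{(a, b), (Suc a, b)} \<in> ?A" "{(a, Suc b), (Suc a, Suc b)} \<in> ?A"
    using c ab by (auto intro!: exI)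
  moreover have "{(a, b), (a, Suc b)} \<in> ?B"
    using c ab by (intro CollectI exI[of _ a] exI[of _ b]) auto
  moreover have "{(Suc a, b), (Suc a, Suc b)} \<in> ?B"
    using c ab by (intro CollectI exI[of _ "Suc a"] exI[of _ b]) auto
  ultimately show "e \<in> ?A \<union> ?B" by blast
next
  fix e assume "e \<in> ?A \<union> ?B"
  then show "e \<in> ?L"
  proof
    assume "e \<in> ?A"
    then obtain i j where e: "e = {(i, j), (Suc i, j)}" "i < length w" "j \<le> Suc (w ! i)" by auto
    have "(Suc i, max 1 j) \<in> bargraph w" using e by (auto simp: bargraph_def)
    moreover have "e \<in> cell_sides (Suc i, max 1 j)"
      using e by (cases "j = 0") (auto simp: cell_sides_def insert_commute)
    ultimately show ?thesis unfolding word_graph_def snd_conv by blast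
  next
    assume "e \<in> ?B"
    then obtain i j where e: "e = {(i, j), (i, Suc j)}" and
      "(i < length w \<and> j \<le> w ! i) \<or> (0 < i \<and> i \<le> length w \<and> j \<le> w ! (i - 1))" by auto
    then consider "i < length w" "j \<le> w ! i" | "0 < i" "i \<le> length w" "j \<le> w ! (i - 1)" by blast
    then show ?thesis
    proof cases
      case 1
      have "(Suc i, Suc j) \<in> bargraph w" using 1 by (auto simp: bargraph_def)
      moreover have "e \<in> cell_sides (Suc i, Suc j)"
        using e by (auto simp: cell_sides_def insert_commute)
      ultimately show ?thesis unfolding word_graph_def snd_conv by blast
    next
      case 2
      have "(i, Suc j) \<in> bargraph w" using 2 by (auto simp: bargraph_def)
      moreover have "e \<in> cell_sides (i, Suc j)"
        using e by (auto simp: cell_sides_def insert_commute)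
      ultimately show ?thesis unfolding word_graph_def snd_conv by blast
    qed
  qed
qed

lemma grid_edge_eq_iff:
  "{(i, j), (Suc i, j)} = {(i', j'), (Suc i', j')} \<longleftrightarrow> i = i' \<and> j = j'"
  "{(i, j), (i, Suc j)} = {(i', j'), (i', Suc j')} \<longleftrightarrow> i = i' \<and> j = j'"
  "{(i, j), (Suc i, j)} \<noteq> {(i', j'), (i', Suc j')}"
  "{(i, j), (i, Suc j)} \<noteq> {(i', j'), (Suc i', j')}"
  for i j i' j' :: nat
  by (auto simp: doubleton_eq_iff)

lemma horizontal_edge_iff:
  "{(i, j), (Suc i, j)} \<in> snd (word_graph w) \<longleftrightarrow> i < length w \<and> j \<le> Suc (w ! i)"
  unfolding snd_word_graph Un_iff mem_Collect_eq by (simp add: grid_edge_eq_iff)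

lemma vertical_edge_iff:
  "{(i, j), (i, Suc j)} \<in> snd (word_graph w) \<longleftrightarrow>
    (i < length w \<and> j \<le> w ! i) \<or> (0 < i \<and> i \<le> length w \<and> j \<le> w ! (i - 1))"
  unfolding snd_word_graph Un_iff mem_Collect_eq by (simp add: grid_edge_eq_iff)

lemma word_graph_neighbour_cases:
  assumes "{u, (i, j)} \<in> snd (word_graph w)"
  shows "u = (Suc i, j) \<or> u = (i, Suc j) \<or> (0 < i \<and> u = (i - 1, j)) \<or> (0 < j \<and> u = (i, j - 1))"
proof -
  from assms obtain a b where
    "{u, (i, j)} = {(a, b), (Suc a, b)} \<or> {u, (i, j)} = {(a, b), (a, Suc b)}"
    unfolding snd_word_graph by blast
  then show ?thesis by (auto simp: doubleton_eq_iff)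
qed

section \<open>Bargraphs of binary words\<close>

locale binary_word =
  fixes w :: "nat list" and n :: nat
  assumes length_w: "length w = n" and n_pos: "0 < n" and letters: "set w \<subseteq> {0, 1}"
begin

text \<open>The columns of three vertices.\<close>

definition tall :: "nat \<Rightarrow> bool" where
  "tall i \<longleftrightarrow> (i < n \<and> w ! i = 1) \<or> (0 < i \<and> i \<le> n \<and> w ! (i - 1) = 1)"

lemma letter_cases: "i < n \<Longrightarrow> w ! i = 0 \<or> w ! i = 1"
  using letters length_w nth_mem[of i w] by blast

lemma letter_le: "i < n \<Longrightarrow> w ! i \<le> 1"
  using letter_cases[of i] by auto

lemma vertex_iff: "(i, j) \<in> fst (word_graph w) \<longleftrightarrow> i \<le> n \<and> (j \<le> 1 \<or> tall i \<and> j = 2)"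
proof -
  have *: "j \<le> Suc (w ! i) \<longleftrightarrow> j \<le> 1 \<or> w ! i = 1 \<and> j = 2" if "i < n" for i
    using letter_cases[OF that] by auto
  have **: "j \<le> Suc (w ! (i - 1)) \<longleftrightarrow> j \<le> 1 \<or> w ! (i - 1) = 1 \<and> j = 2" if "0 < i" "i \<le> n"
    using *[of "i - 1"] that by simp
  have "(i, j) \<in> fst (word_graph w) \<longleftrightarrow>
      (i < n \<and> j \<le> Suc (w ! i)) \<or> (0 < i \<and> i \<le> n \<and> j \<le> Suc (w ! (i - 1)))"
    by (simp add: fst_word_graph length_w)
  also have "\<dots> \<longleftrightarrow> i \<le> n \<and> (j \<le> 1 \<or> tall i \<and> j = 2)"
    using * ** n_pos unfolding tall_def by (cases "i < n"; cases "0 < i"; cases "i \<le> n") auto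
  finally show ?thesis .
qed

lemma vertical_edge_low: "i \<le> n \<Longrightarrow> {(i, 0), (i, 1)} \<in> snd (word_graph w)"
  using vertical_edge_iff[of i 0 w] n_pos length_w by auto

lemma vertical_edge_high_iff: "{(i, 1), (i, 2)} \<in> snd (word_graph w) \<longleftrightarrow> tall i"
proof -
  have "1 \<le> w ! i \<longleftrightarrow> w ! i = 1" if "i < n" for i
    using letter_cases[OF that] by auto
  from this[of i] this[of "i - 1"] show ?thesis
    using vertical_edge_iff[of i 1 w] length_w by (auto simp: tall_def numeral_2_eq_2)
qed

subsection \<open>Hamiltonian cycles force odd runs\<close>

lemma hamiltonian_cycle_imp_odd_runs:
  assumes hc: "hamiltonian_cycle (word_graph w) p"
    and i: "i \<le> n" "i = n \<or> w ! i = 0"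
  shows "run w i = 0 \<or> odd (run w i)"
proof -
  let ?V = "fst (word_graph w)" and ?E = "snd (word_graph w)"
  define C where "C = cycle_edges p"
  have p: "3 \<le> length p" "distinct p" "set p = ?V" "C \<subseteq> ?E"
    using hc by (auto simp: hamiltonian_cycle_iff C_def)
  have loop: "{u} \<notin> C" for u
    using cycle_edges_not_singleton[OF p(1,2)] by (simp add: C_def)
  \<comment> \<open>For \<open>i = 0\<close> or \<open>j = 0\<close> truncated subtraction gives a singleton, which is not an edge.\<close>
  define h :: "nat \<Rightarrow> nat \<Rightarrow> nat" where "h i j = of_bool ({(i - 1, j), (i, j)} \<in> C)" for i j
  define v :: "nat \<Rightarrow> nat \<Rightarrow> nat" where "v i j = of_bool ({(i, j - 1), (i, j)} \<in> C)" for i j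
  \<comment> \<open>Every vertex has degree two in the cycle, and its degree is the sum of the
    indicators of the four grid edges around it.\<close>
  have deg: "h i j + h (Suc i) j + v i j + v i (Suc j) = 2" if "(i, j) \<in> ?V" for i j
  proof -
    define f :: "nat \<times> nat \<Rightarrow> nat" where "f u = of_bool ({u, (i, j)} \<in> C)" for u
    define T where "T = {(Suc i, j), (i, Suc j), (i - 1, j), (i, j - 1)}"
    have "{u. {u, (i, j)} \<in> C} \<subseteq> T"
      using p(4) word_graph_neighbour_cases[of _ i j w] unfolding T_def by blast
    then have "T \<inter> {u. {u, (i, j)} \<in> C} = {u. {u, (i, j)} \<in> C}" by blast
    moreover have "finite T" by (simp add: T_def)
    ultimately have "card {u. {u, (i, j)} \<in> C} = (\<Sum>u\<in>T. f u)"
      by (simp add: f_def)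
    moreover have "card {u. {u, (i, j)} \<in> C} = 2"
      using card_cycle_neighbours[OF p(1,2)] that p(3) by (simp add: C_def)
    \<comment> \<open>On the left or bottom border, truncated subtraction puts the vertex itself
      into \<open>T\<close>; it must not contribute to the sum.\<close>
    moreover have "f (i, j) = 0" using loop by (simp add: f_def)
    moreover have "h i j = f (i - 1, j)" "v i j = f (i, j - 1)"
      by (simp_all add: f_def h_def v_def)
    moreover have "h (Suc i) j = f (Suc i, j)" "v i (Suc j) = f (i, Suc j)"
      by (simp_all add: f_def h_def v_def insert_commute)
    ultimately show ?thesis
      unfolding T_def by (cases i; cases j) auto
  qed
  have h_le: "h i j \<le> 1" for i j by (simp add: h_def)
  have h_0: "h 0 j = 0" for j using loop by (simp add: h_def)
  have v_0: "v i 0 = 0" for i using loop by (simp add: v_def)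
  have h_Suc: "h (Suc i) j = 0" if "\<not> (i < n \<and> j \<le> Suc (w ! i))" for i j
    using that p(4) horizontal_edge_iff[of i j w] length_w by (auto simp: h_def)
  have h_2: "h i 2 = 0" if "\<not> (0 < i \<and> i \<le> n \<and> w ! (i - 1) = 1)" for i
    using that h_0 h_Suc[of "i - 1" 2] letter_cases[of "i - 1"] by (cases i) auto
  have v_2: "v i 2 = 0" if "\<not> tall i" for i
    using that p(4) vertical_edge_high_iff[of i] by (auto simp: v_def)
  have v_3: "v i 3 = 0" for i
  proof -
    have "\<not> 2 \<le> w ! i" if "i < n" using letter_le[OF that] by simp
    moreover have "\<not> 2 \<le> w ! (i - 1)" if "0 < i" "i \<le> n" using letter_le[of "i - 1"] that by (cases i) auto
    ultimately have "{(i, 2), (i, 3)} \<notin> ?E"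
      using vertical_edge_iff[of i 2 w] length_w by (auto simp: numeral_3_eq_3 numeral_2_eq_2)
    then show ?thesis using p(4) by (auto simp: v_def)
  qed
  have deg0: "h i 0 + h (Suc i) 0 + v i 1 = 2" if "i \<le> n" for i
    using deg[of i 0] that vertex_iff v_0 by simp
  have deg1: "h i 1 + h (Suc i) 1 + v i 1 + v i 2 = 2" if "i \<le> n" for i
    using deg[of i 1] that vertex_iff by (simp add: numeral_2_eq_2)
  have deg2: "h i 2 + h (Suc i) 2 + v i 2 = 2" if "i \<le> n" "tall i" for i
    using deg[of i 2] that vertex_iff v_3 by (simp add: numeral_3_eq_3 numeral_2_eq_2)
  \<comment> \<open>Counts the crossings of the gap between columns \<open>i - 1\<close> and
    \<open>i\<close>.\<close>
  define cross where "cross i = h i 0 + h i 1 + h i 2" for i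
  \<comment> \<open>Sum of the degrees over the column: each vertical edge inside it is counted at
    both of its ends.\<close>
  have col_tall: "cross i + cross (Suc i) + 2 * (v i 1 + v i 2) = 6" if "i \<le> n" "tall i" for i
    using deg0[of i] deg1[of i] deg2[of i] that by (simp add: cross_def)
  have col_low: "cross i + cross (Suc i) + 2 * v i 1 = 4" if "i \<le> n" "\<not> tall i" for i
  proof -
    have "h i 2 = 0" "h (Suc i) 2 = 0" "v i 2 = 0"
      using that h_2[of i] h_2[of "Suc i"] v_2[of i] by (auto simp: tall_def)
    then show ?thesis using deg0[of i] deg1[of i] that by (simp add: cross_def)
  qed
  \<comment> \<open>The column sums give consecutive gaps the same parity, and nothing crosses to
    the left of column 0.\<close>
  have cross_even: "even (cross i)" if "i \<le> n" for i
    using that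
  proof (induction i)
    case 0
    then show ?case by (simp add: cross_def h_0)
  next
    case (Suc i)
    then have i: "i \<le> n" "even (cross i)" by auto
    have "even (cross i + cross (Suc i))"
    proof (cases "tall i")
      case True
      show ?thesis using col_tall[OF i(1) True] by presburger
    next
      case False
      show ?thesis using col_low[OF i(1) False] by presburger
    qed
    then show ?case using i(2) by simp
  qed
  \<comment> \<open>The gap separates the bottom corners \<open>(0, 0)\<close> and
    \<open>(n, 0)\<close>, both of which the cycle visits.\<close>
  have cross_pos: "0 < cross i" if i: "0 < i" "i \<le> n" for i
  proof -
    have "(0, 0) \<in> set p" "(n, 0) \<in> set p" using p(3) vertex_iff by auto
    then have "\<exists>a b. {a, b} \<in> C \<and> fst a < i \<and> \<not> fst b < i"
      using i unfolding C_def
      by (intro cycle_crosses_cut[of "(0, 0)" p "\<lambda>u. fst u < i" "(n, 0)"]) simp_all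
    then obtain a b where ab: "{a, b} \<in> C" "fst a < i" "\<not> fst b < i" by blast
    obtain c d where b: "b = (c, d)" by fastforce
    have "{a, (c, d)} \<in> ?E" using ab b p(4) by auto
    from word_graph_neighbour_cases[OF this] have "a = (c - 1, d) \<and> 0 < c"
      using ab b by auto
    with ab b have c: "c = i" "a = (i - 1, d)" by auto
    then have h1: "h i d = 1" using ab b by (simp add: h_def)
    then have "d \<le> Suc (w ! (i - 1))" using h_Suc[of "i - 1" d] i by (cases "d \<le> Suc (w ! (i - 1))") auto
    then have "d = 0 \<or> d = 1 \<or> d = 2" using letter_le[of "i - 1"] i by (cases i) auto
    then show ?thesis using h1 by (auto simp: cross_def)
  qed
  have cross_2: "cross i = 2" if "0 < i" "i \<le> n" for i
  proof -
    have "cross i \<le> 3" using h_le[of i 0] h_le[of i 1] h_le[of i 2] by (simp add: cross_def)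
    then show ?thesis using cross_pos[OF that] cross_even[OF that(2)] by presburger
  qed
  have cross_Suc_n: "cross (Suc n) = 0"
    using h_Suc[of n] by (simp add: cross_def)
  \<comment> \<open>The middle row, with virtual used edges to the left of column 0 and to the right of
    column \<open>n\<close>.\<close>
  define m where "m i = (if 0 < i \<and> i \<le> n then h i 1 else 1)" for i
  \<comment> \<open>Above a zero letter there is no top edge, so the two crossings use the bottom
    and the middle row.\<close>
  have m_zero: "m (Suc i) = 1" if "i = n \<or> w ! i = 0" "i \<le> n" for i
  proof (cases "i = n")
    case False
    then have "h (Suc i) 2 = 0" using h_2[of "Suc i"] that by auto
    then show ?thesis
      using False that cross_2[of "Suc i"] h_le[of "Suc i" 0] h_le[of "Suc i" 1]
      by (simp add: cross_def m_def)
  qed (simp add: m_def)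
  \<comment> \<open>In the interior, \<open>col_tall\<close> leaves one vertical edge, so the middle
    vertex has one horizontal edge. At either end of the word both vertical edges are used, and the
    virtual edge supplies the missing 1.\<close>
  have m_tall: "m i + m (Suc i) = 1" if i: "i \<le> n" "tall i" for i
  proof -
    consider "i = 0" | "0 < i" "i < n" | "0 < i" "i = n" using i by linarith
    then show ?thesis
    proof cases
      case 1
      then have "cross i = 0" "cross (Suc i) = 2" using cross_2[of 1] n_pos
        by (simp_all add: cross_def h_0)
      then show ?thesis using col_tall[OF i] deg1[of i] 1 n_pos by (simp add: m_def)
    next
      case 2
      then show ?thesis
        using col_tall[OF i] deg1[of i] cross_2[of i] cross_2[of "Suc i"] by (simp add: m_def)
    next
      case 3
      then have "h (Suc i) 1 = 0" using h_Suc[of n 1] by simp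
      then show ?thesis
        using 3 col_tall[OF i] deg1[of i] cross_2[of i] cross_Suc_n by (simp add: m_def)
    qed
  qed
  \<comment> \<open>The value starts at 1, flips at each one and returns to 1 after each zero,
    exactly as the parity of \<open>run\<close> does.\<close>
  have m_run: "m i = of_bool (even (run w i))" if "i \<le> n" for i
    using that
  proof (induction i)
    case 0
    then show ?case by (simp add: m_def)
  next
    case (Suc i)
    show ?case
    proof (cases "w ! i = 1")
      case True
      then have "tall i" using Suc by (simp add: tall_def)
      then show ?thesis using Suc m_tall[of i] True by (auto split: if_splits)
    next
      case False
      then have "w ! i = 0" using letter_cases[of i] Suc.prems by auto
      then show ?thesis using m_zero[of i] Suc by simp
    qed
  qed
  \<comment> \<open>In a tall column \<open>m_zero\<close> and \<open>m_tall\<close> force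
    \<open>m i = 0\<close>, so the run is odd; otherwise the letter before \<open>i\<close>, if any,
    is not a one and the run is empty.\<close>
  show ?thesis
  proof (cases "tall i")
    case True
    then show ?thesis
      using m_tall[of i] m_zero[of i] m_run[of i] i by (auto split: if_splits)
  next
    case False
    then show ?thesis using i by (cases i) (auto simp: tall_def)
  qed
qed

subsection \<open>Odd runs suffice\<close>

text \<open>The order in which the upper path passes through column \<open>i\<close>: it climbs
  after an even number of ones and descends after an odd number, so that consecutive columns of a
  run are joined at equal height.\<close>

definition column :: "nat \<Rightarrow> (nat \<times> nat) list" where
  "column i = (if \<not> tall i then [(i, 1)] else if even (run w i) then [(i, 1), (i, 2)]
    else [(i, 2), (i, 1)])"

lemma odd_runs_imp_hamiltonian:
  assumes odd_runs: "\<And>i. i \<le> n \<Longrightarrow> i = n \<or> w ! i = 0 \<Longrightarrow> run w i = 0 \<or> odd (run w i)"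
  shows "\<exists>p. hamiltonian_cycle (word_graph w) p"
proof -
  let ?V = "fst (word_graph w)" and ?E = "snd (word_graph w)"
  let ?R = "\<lambda>u v. {u, v} \<in> ?E"
  define upper where "upper m = concat (map column [0..<Suc m])" for m
  define lower where "lower m = map (\<lambda>i. (i, 0::nat)) [0..<Suc m]" for m
  have upper_Suc: "upper (Suc m) = upper m @ column (Suc m)" for m
    by (simp add: upper_def)
  have lower_Suc: "lower (Suc m) = lower m @ [(Suc m, 0)]" for m
    by (simp add: lower_def)
  have column_ne: "column i \<noteq> []" for i by (simp add: column_def)
  have column_adj: "successively ?R (column i)" for i
    using vertical_edge_high_iff[of i] by (auto simp: column_def insert_commute)
  have set_column: "set (column i) = {(i, j) | j. j = 1 \<or> tall i \<and> j = 2}" for i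
    by (auto simp: column_def)
  \<comment> \<open>Across a one the parity of \<open>run\<close> flips, so both ends lie in the
    same row. Across a zero the preceding run is empty or odd, so the path has come back to the
    middle row, where the next column begins.\<close>
  have step: "{last (column i), hd (column (Suc i))} \<in> ?E" if i: "i < n" for i
  proof (cases "w ! i = 1")
    case True
    then have "tall i" "tall (Suc i)" using i by (auto simp: tall_def)
    then show ?thesis
      using True horizontal_edge_iff[of i 1 w] horizontal_edge_iff[of i 2 w] i length_w
      by (auto simp: column_def)
  next
    case False
    then have 0: "w ! i = 0" using letter_cases[OF i] by simp
    have "last (column i) = (i, 1)"
      using odd_runs[of i] 0 i by (cases "run w i = 0"; cases i) (auto simp: column_def tall_def)
    moreover have "hd (column (Suc i)) = (Suc i, 1)"
      using 0 by (simp add: column_def)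
    ultimately show ?thesis
      using horizontal_edge_iff[of i 1 w] i length_w by simp
  qed
  have upper: "upper m \<noteq> [] \<and> successively ?R (upper m) \<and> hd (upper m) = (0, 1) \<and>
      last (upper m) = last (column m)" if "m \<le> n" for m
    using that
  proof (induction m)
    case 0
    then show ?case using column_adj[of 0] by (simp add: upper_def column_def)
  next
    case (Suc m)
    then show ?case using column_adj[of "Suc m"] column_ne step[of m]
      by (simp add: upper_Suc successively_append_iff)
  qed
  have lower: "lower m \<noteq> [] \<and> successively ?R (lower m) \<and> hd (lower m) = (0, 0) \<and>
      last (lower m) = (m, 0)" if "m \<le> n" for m
    using that
  proof (induction m)
    case 0
    then show ?case by (simp add: lower_def)
  next
    case (Suc m)
    then show ?case using horizontal_edge_iff[of m 0 w] length_w
      by (simp add: lower_Suc successively_append_iff)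
  qed
  have set_upper: "set (upper m) = {(i, j). i \<le> m \<and> (j = 1 \<or> tall i \<and> j = 2)}" for m
    by (auto simp: upper_def set_column)
  have set_lower: "set (lower m) = {(i, 0) | i. i \<le> m}" for m
    by (auto simp: lower_def)
  have "distinct (upper m)" for m
  proof (induction m)
    case 0
    then show ?case by (simp add: upper_def column_def)
  next
    case (Suc m)
    moreover have "distinct (column (Suc m))" by (simp add: column_def)
    moreover have "set (upper m) \<inter> set (column (Suc m)) = {}"
      by (auto simp: set_upper set_column)
    ultimately show ?case by (simp add: upper_Suc)
  qed
  moreover have "distinct (lower m)" for m
    by (auto simp: lower_def distinct_map inj_on_def)
  moreover have "set (upper m) \<inter> set (lower m) = {}" for m
    by (auto simp: set_upper set_lower)
  \<comment> \<open>The cycle runs to the right along the upper path and returns along the bottom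
    row.\<close>
  ultimately have dist: "distinct (upper n @ rev (lower n))"
    by simp
  have set: "set (upper n @ rev (lower n)) = ?V"
  proof (intro set_eqI)
    fix u :: "nat \<times> nat"
    obtain i j where "u = (i, j)" by fastforce
    then show "u \<in> set (upper n @ rev (lower n)) \<longleftrightarrow> u \<in> ?V"
      using vertex_iff[of i j] by (auto simp: set_upper set_lower)
  qed
  have "length (lower n) = Suc n" by (simp add: lower_def)
  moreover have "length (upper n) \<ge> 1" using upper[of n] by (cases "upper n") auto
  ultimately have len: "3 \<le> length (upper n @ rev (lower n))" using n_pos by simp
  \<comment> \<open>The last run is empty or odd, so the upper path ends directly above
    \<open>(n, 0)\<close>.\<close>
  have last: "last (column n) = (n, 1)"
  proof (cases "tall n")
    case True
    then have "w ! (n - 1) = 1" by (simp add: tall_def)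
    then have "run w n \<noteq> 0" using n_pos by (cases n) auto
    then show ?thesis using odd_runs[of n] True by (simp add: column_def)
  qed (simp add: column_def)
  have lowadj: "successively ?R (rev (lower n))"
    using lower[of n] by (simp add: insert_commute)
  have "cycle_edges (upper n @ rev (lower n)) \<subseteq> ?E"
  proof (rule cycle_edges_subset_if_successively)
    show "successively ?R (upper n @ rev (lower n))"
      using upper[of n] lowadj lower[of n] last vertical_edge_low[of n]
      by (simp add: successively_append_iff hd_rev insert_commute)
    show "{last (upper n @ rev (lower n)), hd (upper n @ rev (lower n))} \<in> ?E"
      using upper[of n] lower[of n] vertical_edge_low[of 0] by (simp add: last_rev)
  qed
  then show ?thesis using dist set len unfolding hamiltonian_cycle_iff by blast
qed

lemma Ham_word_graph:
  "Ham (word_graph w) = of_bool (w \<in> run_words {m. m = 0 \<or> odd m} n)"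
proof -
  have "w \<in> run_words {m. m = 0 \<or> odd m} n \<longleftrightarrow>
      (\<forall>i\<le>n. i = n \<or> w ! i = 0 \<longrightarrow> run w i = 0 \<or> odd (run w i))"
    using length_w letters by (simp add: run_words_def)
  also have "\<dots> \<longleftrightarrow> (\<exists>p. hamiltonian_cycle (word_graph w) p)"
    (is "?L \<longleftrightarrow> ?R")
  proof
    assume L: ?L
    show ?R by (rule odd_runs_imp_hamiltonian) (rule L[rule_format])
  next
    assume ?R
    then obtain p where "hamiltonian_cycle (word_graph w) p" by blast
    from hamiltonian_cycle_imp_odd_runs[OF this] show ?L by (intro allI impI)
  qed
  finally show ?thesis by (simp add: Ham_def)
qed

end

section \<open>The generating function\<close>

text \<open>\<open>C'\<close> counts the words with Hamiltonian graph and \<open>C - C'\<close> the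
  others. The empty word, which \<open>H\<close> omits, cancels in the difference and is removed by
  the \<open>- 1\<close>.\<close>

lemma H_eq_run_words_fps:
  assumes "k > 0"
  defines "C \<equiv> run_words_fps {..<k}"
    and "C' \<equiv> run_words_fps {m. m < k \<and> (m = 0 \<or> odd m)}"
  shows "H k = C - C' + fps_const qvar * (C' - 1)"
proof (rule fps_ext)
  fix n
  let ?S = "{m. m = 0 \<or> odd m}" and ?T = "{m. m < k \<and> (m = 0 \<or> odd m)}"
  have T: "run_words ?T n = run_words {..<k} n \<inter> run_words ?S n"
    by (auto simp: run_words_def)
  show "H k $ n = (C - C' + fps_const qvar * (C' - 1)) $ n"
  proof (cases "n = 0")
    case True
    have "run_words {..<k} 0 = {[]}" "run_words ?T 0 = {[]}"
      using assms by (auto simp: run_words_def)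
    then show ?thesis using True by (simp add: H_def C_def C'_def run_words_fps_def)
  next
    case False
    let ?A = "run_words {..<k} n" and ?B = "run_words ?T n"
    have BA: "?B \<subseteq> ?A" using T by blast
    have "H k $ n = (\<Sum>w\<in>?A. qvar ^ Ham (word_graph w))"
      using False by (simp add: H_def free_words_eq_run_words)
    also have "\<dots> = (\<Sum>w\<in>?A. if w \<in> ?B then qvar else 1)"
    proof (intro sum.cong refl)
      fix w assume w: "w \<in> ?A"
      then interpret binary_word w n
        using False by unfold_locales (auto simp: run_words_def)
      show "qvar ^ Ham (word_graph w) = (if w \<in> ?B then qvar else 1)"
        using w by (simp add: Ham_word_graph T)
    qed
    also have "\<dots> = (\<Sum>w\<in>?A - ?B. 1) + (\<Sum>w\<in>?B. qvar)"
      unfolding sum.subset_diff[OF BA finite_run_words]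
      by (intro arg_cong2[where f = "(+)"] sum.cong refl) auto
    also have "\<dots> = of_nat (card ?A) - of_nat (card ?B) + of_nat (card ?B) * qvar"
      using BA by (simp add: card_Diff_subset finite_run_words card_mono of_nat_diff)
    finally show ?thesis
      using False by (simp add: C_def C'_def run_words_fps_def algebra_simps)
  qed
qed

text \<open>Multiplying the functional equation by \<open>1 - fps_X\<close> turns the geometric sum
  into a closed form.\<close>

lemma run_words_fps_lessThan:
  "(1 - 2 * fps_X + fps_X ^ (k + 1)) * run_words_fps {..<k} = 1 - (fps_X :: 'a::field fps) ^ k"
proof -
  let ?x = "fps_X :: 'a fps" and ?A = "run_fps {..<k} :: 'a fps" and ?C = "run_words_fps {..<k} :: 'a fps"
  have "?C * (1 - ?x) = (1 - ?x) * ?A + ?x * ((1 - ?x) * ?A) * ?C"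
    by (subst run_words_fps_eq) (simp only: ring_distribs ac_simps)
  then show ?thesis
    unfolding run_fps_lessThan by (simp add: algebra_simps)
qed

text \<open>The same elimination, now with the multiplier \<open>1 - fps_X\<^sup>2\<close>.\<close>

lemma run_words_fps_odd_lessThan:
  assumes "k > 0"
  shows "(1 - fps_X - 2 * fps_X\<^sup>2 + fps_X ^ 3 + fps_X ^ (2 * (1 + k div 2))) *
      run_words_fps {m. m < k \<and> (m = 0 \<or> odd m)} =
    1 + fps_X - fps_X\<^sup>2 - fps_X * (fps_X :: 'a::field fps) ^ (2 * (k div 2))"
proof -
  let ?x = "fps_X :: 'a fps" and ?S = "{m. m < k \<and> (m = 0 \<or> odd m)}"
  define A where "A = (run_fps ?S :: 'a fps)"
  define C where "C = (run_words_fps ?S :: 'a fps)"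
  define y where "y = ?x ^ (2 * (k div 2))"
  have C: "C = A + ?x * A * C" unfolding A_def C_def by (rule run_words_fps_eq)
  have A: "(1 - ?x\<^sup>2) * A = 1 - ?x\<^sup>2 + ?x - ?x * y"
    unfolding A_def y_def using run_fps_odd_lessThan[OF assms] by simp
  have y: "?x ^ (2 * (1 + k div 2)) = ?x\<^sup>2 * y"
    unfolding y_def power_add[symmetric] by simp
  have "(1 - ?x - 2 * ?x\<^sup>2 + ?x ^ 3 + ?x\<^sup>2 * y) * C = 1 + ?x - ?x\<^sup>2 - ?x * y"
    using A C by algebra
  then show ?thesis unfolding y by (simp add: C_def y_def)
qed

theorem theorem4p1:
  fixes k :: nat and x q :: "int poly fract fps"
  assumes "k \<ge> 2"
  defines "x \<equiv> fps_X" and "q \<equiv> fps_const qvar"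
  shows "H k =
    (x * ((1 - x) * x * (1 - x ^ (2 * ((k - 1) div 2)))
          - q * (1 + x) * (1 - 2 * x + x ^ (k + 1)) * (-2 + x + x ^ (2 * (k div 2)))))
    / ((1 - 2 * x + x ^ (k + 1)) * (1 - x - 2 * x\<^sup>2 + x ^ 3 + x ^ (2 * (1 + k div 2))))"
proof -
  define C where "C = (run_words_fps {..<k} :: int poly fract fps)"
  define C' where "C' = (run_words_fps {m. m < k \<and> (m = 0 \<or> odd m)} :: int poly fract fps)"
  \<comment> \<open>With \<open>y\<close> and \<open>z\<close> for the powers depending on
    \<open>k\<close>, the remaining identities become polynomial.\<close>
  define y where "y = x ^ (2 * (k div 2))"
  define z where "z = x ^ (k - 1)"
  define D where "D = 1 - 2 * x + x ^ (k + 1)"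
  define D' where "D' = 1 - x - 2 * x\<^sup>2 + x ^ 3 + x ^ (2 * (1 + k div 2))"
  have H: "H k = C - C' + q * (C' - 1)"
    using H_eq_run_words_fps[of k] assms(1) unfolding C_def C'_def q_def by simp
  have xk: "x ^ k = x * z" "x ^ (k + 1) = x\<^sup>2 * z"
    using assms(1) by (auto simp: z_def power_add[symmetric] power_Suc[symmetric] simp del: power_Suc)
  have D: "D = 1 - 2 * x + x\<^sup>2 * z" by (simp add: D_def xk(2)[simplified])
  have D': "D' = 1 - x - 2 * x\<^sup>2 + x ^ 3 + x\<^sup>2 * y" 
    unfolding D'_def y_def power_add[symmetric] by simp
  have C: "D * C = 1 - x * z"
    using run_words_fps_lessThan[of k, where 'a = "int poly fract"] xk
    unfolding C_def D_def x_def by simp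
  have C': "D' * C' = 1 + x - x\<^sup>2 - x * y"
    using run_words_fps_odd_lessThan[of k, where 'a = "int poly fract"] assms(1)
    unfolding C'_def D'_def x_def y_def by simp
  \<comment> \<open>This is the part of the numerator free of \<open>q\<close>, up to the factor
    \<open>x\<close>. Only here does the parity of \<open>k\<close> matter: \<open>y = x * z\<close>
    for even \<open>k\<close> and \<open>y = z\<close> for odd \<open>k\<close>.\<close>
  have parity: "x * (1 - x ^ (2 * ((k - 1) div 2))) * (1 - x) =
      (2 - z - x * z) * D' - (1 + x) * (2 - x - y) * D"
  proof (cases "even k")
    case True
    then obtain l' where "k = 2 * l'" by (elim evenE)
    then obtain l where l: "k = 2 * Suc l" using assms(1) by (cases l') auto
    then have div: "(k - 1) div 2 = l" by simp
    define t where "t = x ^ (2 * l)"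
    have "y = x\<^sup>2 * t" "z = x * t"
      using l by (simp_all add: y_def z_def t_def power2_eq_square mult.assoc)
    then show ?thesis
      unfolding D D' div t_def[symmetric] by algebra
  next
    case False
    then obtain l where l: "k = 2 * l + 1" by (elim oddE)
    then have yz: "y = z" and zp: "x ^ (2 * ((k - 1) div 2)) = z" by (simp_all add: y_def z_def)
    show ?thesis unfolding D D' yz zp by algebra
  qed
  \<comment> \<open>Splitting off \<open>D\<close> and \<open>D'\<close> makes the constant terms of
    \<open>C - C'\<close> and \<open>C' - 1\<close> cancel.\<close>
  have DC: "D * C = D + x * (2 - z - x * z)"
    unfolding C unfolding D by algebra
  have DC': "D' * C' = D' + x * (1 + x) * (2 - x - y)"
    unfolding C' unfolding D' by algebra
  have "H k * (D * D') = (D * C) * D' - D * (D' * C') + q * D * (D' * C' - D')"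
    unfolding H by (simp add: algebra_simps)
  also have "\<dots> = x * ((2 - z - x * z) * D' - (1 + x) * (2 - x - y) * D)
      + q * D * (x * (1 + x) * (2 - x - y))"
    unfolding DC DC' by algebra
  also have "\<dots> = x * ((1 - x) * x * (1 - x ^ (2 * ((k - 1) div 2)))
          - q * (1 + x) * D * (-2 + x + y))"
    unfolding parity[symmetric] by algebra
  finally have "H k * (D * D') = x * ((1 - x) * x * (1 - x ^ (2 * ((k - 1) div 2)))
          - q * (1 + x) * D * (-2 + x + y))" .
  \<comment> \<open>The constant coefficient 1 makes the product nonzero, so it may be cancelled in
    the division.\<close>
  moreover have "D * D' \<noteq> 0"
  proof -
    have "(D * D') $ 0 = 1"
      using assms(1) by (simp add: D_def D'_def x_def)
    then show ?thesis by auto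
  qed
  ultimately have "H k = (x * ((1 - x) * x * (1 - x ^ (2 * ((k - 1) div 2)))
          - q * (1 + x) * D * (-2 + x + y))) / (D * D')"
    by (metis nonzero_mult_div_cancel_right)
  then show ?thesis by (simp only: D_def D'_def y_def)
qed

end
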